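(* Let $S\in M_{2n}(\mathbb{C})$ be symplectic with $\lambda_1\in\sigma(S)$ and let $\mu\in\mathbb{C}\setminus\{0,\lambda_1,\lambda_1^{-1}\}$ be given. Let $x_1,x_2\in\mathbb{C}^{2n}$ be eigenvectors of $S$ for $\lambda_1$ and $\lambda_1^{-1}$, respectively, such that $X=[\,x_1\;x_2\,]$ satisfies $X^TJX=J_2$, and let $R=[r_{ij}]\in M_2(\mathbb{C})$ satisfy $$(\mu+\mu^{-1})-(\lambda_1+\lambda_1^{-1}) = \lambda_1r_{12}-\lambda_1^{-1}r_{21}\quad\text{and}\quad 0=r_{12}-r_{21}+r_{11}r_{22}-r_{12}r_{21}.$$ Let $\hat{S}=S+XRX^TJ^TS$. Then the following hold: (i) If $\lambda_1\neq\pm1$ and the Segre characteristic of $\lambda_1$ as an eigenvalue of $S$ is $((s_k,s_{k-1},\ldots,s_2,s_1))$ with $s_k\ge s_{k-1}\ge\cdots\ge s_2\ge s_1=1$, then the Segre characteristic of $\lambda_1$ as an eigenvalue of $\hat{S}$ is $((s_k,s_{k-1},\ldots,s_2))$. Moreover, if $\lambda_1=\pm1$ and the Segre characteristic of $\lambda_1$ as an eigenvalue of $S$ is $((s_k,s_{k-1},\ldots,s_2,s_1))$ with $s_k\ge\cdots\ge s_2=s_1=1$, then the Segre characteristic of $\lambda_1$ as an eigenvalue of $\hat{S}$ is $((s_k,s_{k-1},\ldots,s_3))$. (ii) Let $\mu\notin\sigma(S)$. Then the Segre characteristic of $\mu$ as an eigenvalue of $\hat{S}$ is always $((1))$ if $\mu\neq\mu^{-1}$.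 If $\mu=\mu^{-1}$, its Segre characteristic is $((1,1))$ if and only if $R=R_1$ or $R=R_2$, where $$R_1 = \begin{bmatrix} 0 & \lambda_1^{-1}(\mu-\lambda_1)\\ \mu^{-1}(\mu-\lambda_1) & 0\end{bmatrix},\qquad R_2 = \begin{bmatrix} 0 & \mu^{-1}(\lambda_1^{-1}-\mu)\\ \lambda_1(\lambda_1^{-1}-\mu) & 0\end{bmatrix};$$ otherwise it is $((2))$.
   Context: $M_n(\mathbb{C})$ is the set of complex $n\times n$ matrices, $\sigma(S)$ is the spectrum, $^T$ is the transpose without conjugation. $J=J_{2n} = \begin{bmatrix} 0 & I_n \\ -I_n & 0\end{bmatrix}$ and $J_2=\begin{bmatrix}0&1\\-1&0\end{bmatrix}$; $S\in M_{2n}(\mathbb{C})$ is symplectic if $S^TJS=J$. The Segre characteristic of an eigenvalue $\lambda$ of a matrix is the sequence of sizes of its Jordan blocks with eigenvalue $\lambda$ in non-increasing order, written $((\cdot,\ldots,\cdot))$; an empty sequence means that $\lambda$ is not an eigenvalue. *)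

theory Defs
  imports
    "Jordan_Normal_Form.Spectral_Radius"
    "Jordan_Normal_Form.Jordan_Normal_Form_Uniqueness"
begin

definition sympl_form :: "nat \<Rightarrow> complex mat" where
  "sympl_form n = four_block_mat (0\<^sub>m n n) (1\<^sub>m n) (- 1\<^sub>m n) (0\<^sub>m n n)"

lemma sympl_form_1: "sympl_form 1 = mat_of_rows_list 2 [[0, 1], [-1, 0]]"
  by (rule eq_matI) (auto simp: sympl_form_def mat_of_rows_list_def numeral_2_eq_2 less_Suc_eq)

definition symplectic_mat :: "nat \<Rightarrow> complex mat \<Rightarrow> bool" where
  "symplectic_mat n S \<longleftrightarrow>
     S \<in> carrier_mat (2 * n) (2 * n) \<and> S\<^sup>T * sympl_form n * S = sympl_form n"

text \<open>The sizes of the Jordan blocks with eigenvalue \<open>l\<close>, in non-increasing order. By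
  \<open>segre_characteristic_eq\<close> and \<open>complex_jordan_nf_exists\<close> the description is a proper one for
  every square complex matrix, i.e. it does not depend on the Jordan normal form that is used.\<close>

definition segre_characteristic :: "complex mat \<Rightarrow> complex \<Rightarrow> nat list" where
  "segre_characteristic A l =
     (THE ss. \<exists>n_as. jordan_nf A n_as \<and>
        ss = rev (sort (map fst (filter (\<lambda>(k, a). a = l) n_as))))"

lemma complex_jordan_nf_exists:
  fixes A :: "complex mat"
  assumes "A \<in> carrier_mat n n"
  shows "\<exists>n_as. jordan_nf A n_as"
  using jordan_nf_exists[OF assms] char_poly_factorized[OF assms] by blast

lemma jordan_nf_mset_unique:
  assumes A: "jordan_nf (A :: 'a :: field mat) n_as" and B: "jordan_nf A m_bs"
  shows "mset n_as = mset m_bs"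
proof (rule multiset_eqI)
  fix x :: "nat \<times> 'a"
  obtain k e where x: "x = (k, e)" by force
  have cnt: "count (mset xs) x = length (filter ((=) (k, e)) xs)" for xs
    unfolding x by (induction xs) auto
  show "count (mset n_as) x = count (mset m_bs) x"
  proof (cases "k = 0")
    case True
    with A B have "x \<notin> set n_as" "x \<notin> set m_bs"
      unfolding jordan_nf_def x by force+
    thus ?thesis by (metis count_eq_zero_iff set_mset_mset)
  next
    case False
    thus ?thesis unfolding cnt
      using compute_nr_of_jordan_blocks[OF A False] compute_nr_of_jordan_blocks[OF B False] by metis
  qed
qed

lemma segre_characteristic_eq:
  assumes A: "jordan_nf A n_as"
  shows "segre_characteristic A l = rev (sort (map fst (filter (\<lambda>(k, a). a = l) n_as)))"
  unfolding segre_characteristic_def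
proof (rule the_equality)
  fix ss
  assume "\<exists>m_bs. jordan_nf A m_bs \<and> ss = rev (sort (map fst (filter (\<lambda>(k, a). a = l) m_bs)))"
  then obtain m_bs where B: "jordan_nf A m_bs"
    and ss: "ss = rev (sort (map fst (filter (\<lambda>(k, a). a = l) m_bs)))" by blast
  have "mset (map fst (filter (\<lambda>(k, a). a = l) m_bs)) = mset (map fst (filter (\<lambda>(k, a). a = l) n_as))"
    using jordan_nf_mset_unique[OF A B] by simp
  hence "sort (map fst (filter (\<lambda>(k, a). a = l) m_bs)) = sort (map fst (filter (\<lambda>(k, a). a = l) n_as))"
    by (intro properties_for_sort) simp_all
  thus "ss = rev (sort (map fst (filter (\<lambda>(k, a). a = l) n_as)))" using ss by simp
qed (use A in blast)

end

theory Submission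
  imports Defs
begin

text \<open>
  The rows of \<open>Y = J\<^sub>2 X\<^sup>T J\<^sup>T\<close> are left eigenvectors of \<open>S\<close>, and they are dual to the columns of
  \<open>X\<close>: with \<open>D = diag(\<lambda>\<^sub>1, \<lambda>\<^sub>1\<^sup>-\<^sup>1)\<close> one has \<open>S X = X D\<close>, \<open>Y S = D Y\<close> and \<open>Y X = I\<close>. Since
  \<open>X\<^sup>T J\<^sup>T = J\<^sub>2\<^sup>T Y\<close>, the perturbation reads \<open>S' = S + X (M - D) Y\<close> with \<open>M = D + R J\<^sub>2\<^sup>T D\<close>. Thus
  \<open>S\<close> and \<open>S'\<close> both leave the summands of \<open>range X \<oplus> ker Y\<close> invariant and agree on \<open>ker Y\<close>,
  while on \<open>range X\<close> the perturbation replaces the \<open>2 \<times> 2\<close> matrix \<open>D\<close> by \<open>M\<close>.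

  Instead of choosing a basis of \<open>ker Y\<close>, one can compare the two matrices after attaching the
  missing block to each: \<open>diag(S, M)\<close> is similar to \<open>diag(S', D)\<close>, because swapping \<open>range X\<close> with
  the extra two coordinates is an involution (\<open>similar_exchange_block\<close>). As the Jordan blocks of
  a block diagonal matrix are those of its parts, as multisets
  \<open>segre S + segre M = segre S' + segre D\<close> at every eigenvalue.

  The rest concerns \<open>2 \<times> 2\<close> matrices. The two equations for \<open>R\<close> say that \<open>M\<close> has trace
  \<open>\<mu> + \<mu>\<^sup>-\<^sup>1\<close> and determinant \<open>1\<close>, hence eigenvalues \<open>\<mu>\<close> and \<open>\<mu>\<^sup>-\<^sup>1\<close>. At \<open>\<lambda>\<^sub>1\<close> the matrix \<open>M\<close>
  contributes nothing, and \<open>D\<close> contributes one block of size 1, or two if \<open>\<lambda>\<^sub>1 = \<plusminus>1\<close>; these are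
  the blocks that \<open>S'\<close> loses. If \<open>\<mu>\<close> is not an eigenvalue of \<open>S\<close>, then the blocks of \<open>S'\<close> at
  \<open>\<mu>\<close> are those of \<open>M\<close>. For \<open>\<mu> = \<mu>\<^sup>-\<^sup>1\<close> these have size 1 exactly when \<open>M = \<mu> I\<close>; solving for
  \<open>R\<close> gives a single matrix, since \<open>R\<^sub>1 = R\<^sub>2\<close> for such \<open>\<mu>\<close>.
\<close>

section \<open>Matrix algebra\<close>

text \<open>Associativity and transposition of products with conditions on dimensions, which the
  simplifier can solve; the carrier versions leave the inner dimensions to be guessed.\<close>

lemma mult_mat_assoc_dim:
  fixes A :: "'a :: semiring_0 mat"
  assumes "dim_col A = dim_row B" "dim_col B = dim_row C"
  shows "A * B * C = A * (B * C)"
  using assms by (intro assoc_mult_mat[of A "dim_row A" "dim_row B" B "dim_row C" C "dim_col C"]) auto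

lemma transpose_mult_dim:
  fixes A :: "'a :: comm_semiring_0 mat"
  assumes "dim_col A = dim_row B"
  shows "(A * B)\<^sup>T = B\<^sup>T * A\<^sup>T"
  using assms by (intro transpose_mult[of A "dim_row A" "dim_row B" B "dim_col B"]) auto

text \<open>If \<open>Y X = I\<close>, then the space is the direct sum of \<open>range X\<close> and \<open>ker Y\<close>, with projection
  \<open>E = I - X Y\<close> onto \<open>ker Y\<close>. The similarity is given by
  \<open>(v, w) \<mapsto> (E v + X w, Y v)\<close>, which fixes \<open>ker Y\<close> and exchanges \<open>range X\<close> with the
  coordinates \<open>w\<close>; it carries \<open>S\<close> on \<open>ker Y\<close> to itself and the two blocks \<open>D\<close> and \<open>M\<close> to each
  other.\<close>

lemma similar_exchange_block:
  fixes S :: "'a :: comm_ring_1 mat"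
  assumes S: "S \<in> carrier_mat N N" and X: "X \<in> carrier_mat N k" and Y: "Y \<in> carrier_mat k N"
    and D: "D \<in> carrier_mat k k" and M: "M \<in> carrier_mat k k"
    and YX: "Y * X = 1\<^sub>m k" and SX: "S * X = X * D" and YS: "Y * S = D * Y"
    and S': "S' = S + X * (M - D) * Y"
  shows "similar_mat (four_block_mat S (0\<^sub>m N k) (0\<^sub>m k N) M)
                     (four_block_mat S' (0\<^sub>m N k) (0\<^sub>m k N) D)"
proof -
  define E where "E = 1\<^sub>m N - X * Y"
  \<comment> \<open>\<open>W\<close> acts as \<open>S\<close>, and equally as \<open>S'\<close>, on \<open>ker Y\<close> and vanishes on \<open>range X\<close>.\<close>
  define W where "W = S - X * D * Y"
  define T where "T = four_block_mat E X Y (0\<^sub>m k k)"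
  have E: "E \<in> carrier_mat N N" and W: "W \<in> carrier_mat N N" and S'c: "S' \<in> carrier_mat N N"
    unfolding E_def W_def S' using S X Y D M by auto
  have Tc: "T \<in> carrier_mat (N + k) (N + k)" unfolding T_def using E X Y by auto
  have XY: "X * Y \<in> carrier_mat N N" and XMY: "X * M * Y \<in> carrier_mat N N"
    and XDY: "X * D * Y \<in> carrier_mat N N" and MY: "M * Y \<in> carrier_mat k N"
    and DY: "D * Y \<in> carrier_mat k N" and XD: "X * D \<in> carrier_mat N k"
    using X Y M D by auto
  have YXZ: "Y * (X * Z) = Z" if "Z \<in> carrier_mat k m" for Z m
    using assoc_mult_mat[OF Y X that] that by (simp add: YX)
  have S'_eq: "S' = W + X * M * Y"
    unfolding S' W_def mult_minus_distrib_mat[OF X M D]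
      minus_mult_distrib_mat[OF mult_carrier_mat[OF X M] XD Y]
    by (rule eq_matI) (use S XMY XDY in auto)
  have YE: "Y * E = 0\<^sub>m k N"
    unfolding E_def mult_minus_distrib_mat[OF Y one_carrier_mat XY] YXZ[OF Y] using Y by auto
  have EX: "E * X = 0\<^sub>m N k"
    unfolding E_def minus_mult_distrib_mat[OF one_carrier_mat XY X] assoc_mult_mat[OF X Y X] YX
    using X by auto
  have EE: "E * E = E"
    by (subst E_def, unfold minus_mult_distrib_mat[OF one_carrier_mat XY E] assoc_mult_mat[OF X Y E] YE)
       (use X E in auto)
  have YW: "Y * W = 0\<^sub>m k N"
    unfolding W_def mult_minus_distrib_mat[OF Y S XDY] YS
    unfolding assoc_mult_mat[OF X D Y] YXZ[OF DY] using DY by auto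
  have WX: "W * X = 0\<^sub>m N k"
    unfolding W_def minus_mult_distrib_mat[OF S XDY X] SX
      assoc_mult_mat[OF XD Y X] YX right_mult_one_mat[OF XD] using XD by auto
  have EW: "E * W = W"
    unfolding E_def minus_mult_distrib_mat[OF one_carrier_mat XY W] assoc_mult_mat[OF X Y W] YW
    using X W by auto
  have WE: "W * E = W"
    unfolding E_def mult_minus_distrib_mat[OF W one_carrier_mat XY] assoc_mult_mat[OF W X Y, symmetric]
      WX using Y W by auto
  have ES': "E * S' = W"
    unfolding S'_eq mult_add_distrib_mat[OF E W XMY] EW
    unfolding assoc_mult_mat[OF X M Y]
    unfolding assoc_mult_mat[OF E X MY, symmetric] EX left_mult_zero_mat[OF MY] using W by auto
  have YS': "Y * S' = M * Y"
    unfolding S'_eq mult_add_distrib_mat[OF Y W XMY] YW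
    unfolding assoc_mult_mat[OF X M Y] YXZ[OF MY]
    using MY by auto
  have cancel: "A - B + B = A" if "A \<in> carrier_mat N N" "B \<in> carrier_mat N N" for A B :: "'a mat"
    using that by (intro eq_matI) auto
  have EEXY: "E + X * Y = 1\<^sub>m N"
    unfolding E_def by (rule cancel[OF one_carrier_mat XY])
  have WXDY: "W + X * D * Y = S"
    unfolding W_def by (rule cancel[OF S XDY])
  have one: "T * T = 1\<^sub>m (N + k)"
    unfolding T_def
    by (subst mult_four_block_mat[OF E X Y zero_carrier_mat E X Y zero_carrier_mat])
       (use X Y in \<open>simp add: EE EX YE YX EEXY four_block_one_mat\<close>)
  let ?B = "four_block_mat S' (0\<^sub>m N k) (0\<^sub>m k N) D"
  have TB: "T * ?B = four_block_mat W (X * D) (M * Y) (0\<^sub>m k k)"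
    unfolding T_def
    by (subst mult_four_block_mat[OF E X Y zero_carrier_mat S'c zero_carrier_mat zero_carrier_mat D])
       (use X Y D E W MY XD in \<open>simp add: ES' YS'\<close>)
  have MYE: "M * Y * E = 0\<^sub>m k N" and MYX: "M * Y * X = M"
    unfolding assoc_mult_mat[OF M Y E] assoc_mult_mat[OF M Y X] YE YX using M by auto
  have TBT: "T * ?B * T = four_block_mat S (0\<^sub>m N k) (0\<^sub>m k N) M"
    unfolding TB unfolding T_def
    by (subst mult_four_block_mat[OF W XD MY zero_carrier_mat E X Y zero_carrier_mat])
       (use X Y M right_mult_zero_mat[OF XD] in \<open>simp add: WE WX WXDY MYE MYX\<close>)
  show ?thesis
    by (rule similar_matI[OF _ one one TBT[symmetric]]) (use Tc S S'c M D in auto)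
qed

lemma char_poly_2x2:
  fixes A :: "'a :: comm_ring_1 mat"
  assumes A: "A \<in> carrier_mat 2 2"
  shows "char_poly A = [: A $$ (0,0) * A $$ (1,1) - A $$ (0,1) * A $$ (1,0),
                          - (A $$ (0,0) + A $$ (1,1)), 1 :]"
proof -
  let ?C = "char_poly_matrix A"
  have C: "?C \<in> carrier_mat 2 2" using A by simp
  have e: "?C $$ (0,0) = [: - A $$ (0,0), 1 :]" "?C $$ (1,1) = [: - A $$ (1,1), 1 :]"
    "?C $$ (0,1) = [: - A $$ (0,1) :]" "?C $$ (1,0) = [: - A $$ (1,0) :]"
    using A by (auto simp: char_poly_matrix_def)
  have "char_poly A = ?C $$ (0,0) * ?C $$ (1,1) - ?C $$ (0,1) * ?C $$ (1,0)"
    unfolding char_poly_def laplace_expansion_row[OF C, of 0, simplified]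
    using C by (simp add: numeral_2_eq_2 cofactor_def det_single mat_delete_def)
  thus ?thesis unfolding e by (simp add: algebra_simps)
qed

section \<open>Properties of the Segre characteristic\<close>

lemma segre_mset:
  assumes "jordan_nf A n_as"
  shows "mset (segre_characteristic A l) = image_mset fst (filter_mset (\<lambda>(k, a). a = l) (mset n_as))"
  unfolding segre_characteristic_eq[OF assms] by (simp add: mset_filter)

lemma segre_similar:
  assumes sim: "similar_mat A B"
  shows "segre_characteristic A l = segre_characteristic B l"
proof -
  from similar_matD[OF sim] obtain n where A: "A \<in> carrier_mat n n" by auto
  from complex_jordan_nf_exists[OF A] obtain n_as where J: "jordan_nf A n_as" by auto
  hence "jordan_nf B n_as"
    using similar_mat_trans[OF similar_mat_sym[OF sim]] unfolding jordan_nf_def by blast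
  thus ?thesis by (simp add: segre_characteristic_eq[OF J] segre_characteristic_eq)
qed

lemma segre_block_diag:
  assumes A: "A \<in> carrier_mat n n" and B: "B \<in> carrier_mat m m"
  shows "mset (segre_characteristic (four_block_mat A (0\<^sub>m n m) (0\<^sub>m m n) B) l)
       = mset (segre_characteristic A l) + mset (segre_characteristic B l)"
proof -
  obtain as bs where a: "jordan_nf A as" and b: "jordan_nf B bs"
    using complex_jordan_nf_exists[OF A] complex_jordan_nf_exists[OF B] by auto
  have "diag_block_mat [A, B] = four_block_mat A (0\<^sub>m n m) (0\<^sub>m m n) B"
    using A B by (intro eq_matI) auto
  moreover have "jordan_nf (diag_block_mat (map fst [(A, as), (B, bs)]))
                           (concat (map snd [(A, as), (B, bs)]))"
    by (rule jordan_nf_diag_block_mat) (use a b in auto)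
  ultimately have "jordan_nf (four_block_mat A (0\<^sub>m n m) (0\<^sub>m m n) B) (as @ bs)" by simp
  from segre_mset[OF this] show ?thesis by (simp add: segre_mset[OF a] segre_mset[OF b])
qed

lemma sorted_segre:
  assumes A: "A \<in> carrier_mat n n"
  shows "sorted (rev (segre_characteristic A l))"
proof -
  from complex_jordan_nf_exists[OF A] obtain n_as where J: "jordan_nf A n_as" by auto
  show ?thesis unfolding segre_characteristic_eq[OF J] by simp
qed

lemma segre_eqI:
  assumes A: "A \<in> carrier_mat n n"
    and "mset (segre_characteristic A l) = mset ss" and "sorted (rev ss)"
  shows "segre_characteristic A l = ss"
proof -
  have "rev (segre_characteristic A l) = rev ss"
    using assms(2,3) sorted_segre[OF A] by (metis mset_rev properties_for_sort)
  thus ?thesis by simp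
qed

lemma segre_pos:
  assumes A: "A \<in> carrier_mat n n"
  shows "0 \<notin> set (segre_characteristic A l)"
proof -
  from complex_jordan_nf_exists[OF A] obtain n_as where J: "jordan_nf A n_as" by auto
  thus ?thesis unfolding segre_characteristic_eq[OF J] by (auto simp: jordan_nf_def image_iff)
qed

lemma sum_segre:
  assumes A: "A \<in> carrier_mat n n"
  shows "sum_list (segre_characteristic A l) = Polynomial.order l (char_poly A)"
proof -
  from complex_jordan_nf_exists[OF A] obtain n_as where J: "jordan_nf A n_as" by auto
  have "sum_list (segre_characteristic A l) = sum_mset (mset (segre_characteristic A l))"
    by (simp add: sum_mset_sum_list)
  also have "\<dots> = Polynomial.order l (char_poly A)"
    unfolding segre_mset[OF J] jordan_nf_order[OF J]
    by (simp add: case_prod_beta' flip: mset_filter mset_map sum_mset_sum_list)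
  finally show ?thesis .
qed

lemma segre_empty:
  assumes A: "A \<in> carrier_mat n n" and "poly (char_poly A) l \<noteq> 0"
  shows "segre_characteristic A l = []"
proof -
  have "sum_list (segre_characteristic A l) = 0"
    using sum_segre[OF A] assms(2) by (simp add: order_0I)
  thus ?thesis using segre_pos[OF A, of l] by (cases "segre_characteristic A l") auto
qed

text \<open>An eigenvalue of algebraic multiplicity 1 or 2 leaves few possibilities, because the block
  sizes are positive and sum up to the multiplicity.\<close>

lemma segre_simple:
  assumes A: "A \<in> carrier_mat n n" and "Polynomial.order l (char_poly A) = 1"
  shows "segre_characteristic A l = [1]"
proof -
  have s: "sum_list (segre_characteristic A l) = 1" using sum_segre[OF A] assms(2) by simp
  have p: "0 \<notin> set (segre_characteristic A l)" by (rule segre_pos[OF A])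
  obtain x xs where c: "segre_characteristic A l = x # xs"
    using s by (cases "segre_characteristic A l") auto
  have "x > 0" "x + sum_list xs = 1" using p s c by auto
  hence x: "x = 1" "sum_list xs = 0" by linarith+
  with p c have "xs = []" by (cases xs) auto
  with c x show ?thesis by simp
qed

lemma segre_double:
  assumes A: "A \<in> carrier_mat n n" and "Polynomial.order l (char_poly A) = 2"
  shows "segre_characteristic A l = [1, 1] \<or> segre_characteristic A l = [2]"
proof -
  have s: "sum_list (segre_characteristic A l) = 2" using sum_segre[OF A] assms(2) by simp
  have p: "0 \<notin> set (segre_characteristic A l)" by (rule segre_pos[OF A])
  obtain x xs where c: "segre_characteristic A l = x # xs"
    using s by (cases "segre_characteristic A l") auto
  show ?thesis
  proof (cases xs)
    case Nil
    thus ?thesis using c s by simp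
  next
    case (Cons y ys)
    have "x > 0" "y > 0" "x + (y + sum_list ys) = 2" using p s c Cons by auto
    hence "x = 1" "y = 1" "sum_list ys = 0" by linarith+
    moreover from this p c Cons have "ys = []" by (cases ys) auto
    ultimately show ?thesis using c Cons by simp
  qed
qed

lemma jordan_matrix_replicate_1:
  "jordan_matrix (replicate n (1, c)) = c \<cdot>\<^sub>m (1\<^sub>m n :: 'a :: semiring_1 mat)"
proof (induction n)
  case 0
  show ?case by (intro eq_matI) auto
next
  case (Suc n)
  show ?case unfolding replicate_Suc jordan_matrix_Cons Suc
    by (intro eq_matI) (auto simp: sum_list_replicate)
qed

lemma similar_scalar_mat:
  fixes A :: "'a :: comm_ring_1 mat"
  assumes "similar_mat A (c \<cdot>\<^sub>m 1\<^sub>m n)"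
  shows "A = c \<cdot>\<^sub>m 1\<^sub>m n"
proof -
  from similar_matD[OF assms] obtain m P Q where
    c: "{A, c \<cdot>\<^sub>m 1\<^sub>m n, P, Q} \<subseteq> carrier_mat m m" and PQ: "P * Q = 1\<^sub>m m"
    and A: "A = P * (c \<cdot>\<^sub>m 1\<^sub>m n) * Q" by auto
  have m: "m = n" using c by auto
  have P: "P \<in> carrier_mat n n" and Q: "Q \<in> carrier_mat n n" using c m by auto
  show ?thesis unfolding A mult_smult_distrib[OF P one_carrier_mat] right_mult_one_mat[OF P]
      mult_smult_assoc_mat[OF P Q] PQ m by simp
qed

text \<open>The matrix \<open>c I\<close> is alone in its similarity class, and it is the Jordan matrix with \<open>n\<close>
  blocks of size 1 at \<open>c\<close>.\<close>

lemma segre_replicate_1_iff: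
  assumes A: "A \<in> carrier_mat n n" and cp: "char_poly A = [:- c, 1:] ^ n"
  shows "segre_characteristic A c = replicate n 1 \<longleftrightarrow> A = c \<cdot>\<^sub>m 1\<^sub>m n"
proof
  assume "A = c \<cdot>\<^sub>m 1\<^sub>m n"
  hence "jordan_nf A (replicate n (1, c))"
    using A by (auto simp: jordan_nf_def jordan_matrix_replicate_1[unfolded One_nat_def]
        intro: similar_mat_refl[of _ n])
  from segre_characteristic_eq[OF this]
  show "segre_characteristic A c = replicate n 1"
    by (simp add: sorted_sort_id)
next
  assume seg: "segre_characteristic A c = replicate n 1"
  from complex_jordan_nf_exists[OF A] obtain n_as where J: "jordan_nf A n_as" by auto
  have c: "b = c" if "(k, b) \<in> set n_as" for k b
  proof (rule ccontr)
    assume "b \<noteq> c"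
    hence "segre_characteristic A b = []" by (intro segre_empty[OF A]) (simp add: cp poly_power)
    moreover have "k \<in> set (segre_characteristic A b)"
      unfolding segre_characteristic_eq[OF J] using that by force
    ultimately show False by simp
  qed
  have "filter (\<lambda>(k, a). a = c) n_as = n_as" using c by (auto intro: filter_True)
  hence rep: "rev (sort (map fst n_as)) = replicate n 1"
    using seg unfolding segre_characteristic_eq[OF J] by simp
  have "length n_as = n" using arg_cong[OF rep, of length] by simp
  moreover have "set (map fst n_as) \<subseteq> {1}" using arg_cong[OF rep, of set] by (auto split: if_splits)
  ultimately have "n_as = replicate n (1, c)"
    using c by (intro replicate_eqI) force+
  with J have "similar_mat A (c \<cdot>\<^sub>m 1\<^sub>m n)"
    by (simp add: jordan_nf_def jordan_matrix_replicate_1[unfolded One_nat_def])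
  thus "A = c \<cdot>\<^sub>m 1\<^sub>m n" by (rule similar_scalar_mat)
qed

section \<open>The perturbed symplectic matrix\<close>

lemma sympl_form_carrier: "sympl_form n \<in> carrier_mat (2 * n) (2 * n)"
  by (simp add: sympl_form_def mult_2)

lemma mult_mat_2_index:
  assumes "A \<in> carrier_mat n 2" "B \<in> carrier_mat 2 m" "i < n" "j < m"
  shows "(A * B) $$ (i, j) = A $$ (i, 0) * B $$ (0, j) + A $$ (i, 1) * B $$ (1, j)"
  using assms by (simp add: scalar_prod_def numeral_2_eq_2)

theorem theorem8:
  fixes n :: nat and S X R S' R1 R2 :: "complex mat"
    and l1 \<mu> :: complex and x1 x2 :: "complex vec"
  assumes "symplectic_mat n S"
    and "l1 \<in> spectrum S"
    and "\<mu> \<notin> {0, l1, inverse l1}"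
    and "eigenvector S x1 l1"
    and "eigenvector S x2 (inverse l1)"
    and "X = mat_of_cols (2 * n) [x1, x2]"
    and "X\<^sup>T * sympl_form n * X = sympl_form 1"
    and "R \<in> carrier_mat 2 2"
    and "(\<mu> + inverse \<mu>) - (l1 + inverse l1) = l1 * R $$ (0, 1) - inverse l1 * R $$ (1, 0)"
    and "0 = R $$ (0, 1) - R $$ (1, 0) + R $$ (0, 0) * R $$ (1, 1) - R $$ (0, 1) * R $$ (1, 0)"
    and "S' = S + X * R * X\<^sup>T * (sympl_form n)\<^sup>T * S"
    and "R1 = mat_of_rows_list 2
           [[0, inverse l1 * (\<mu> - l1)],
            [inverse \<mu> * (\<mu> - l1), 0]]"
    and "R2 = mat_of_rows_list 2
           [[0, inverse \<mu> * (inverse l1 - \<mu>)],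
            [l1 * (inverse l1 - \<mu>), 0]]"
  shows "(l1 \<notin> {1, -1} \<longrightarrow>
            (\<forall>ss. segre_characteristic S l1 = ss @ [1] \<longrightarrow> segre_characteristic S' l1 = ss))
       \<and> (l1 \<in> {1, -1} \<longrightarrow>
            (\<forall>ss. segre_characteristic S l1 = ss @ [1, 1] \<longrightarrow> segre_characteristic S' l1 = ss))
       \<and> (\<mu> \<notin> spectrum S \<longrightarrow>
            (\<mu> \<noteq> inverse \<mu> \<longrightarrow> segre_characteristic S' \<mu> = [1])
          \<and> (\<mu> = inverse \<mu> \<longrightarrow>
               (segre_characteristic S' \<mu> = [1, 1] \<longleftrightarrow> R = R1 \<or> R = R2)
             \<and> (\<not> (R = R1 \<or> R = R2) \<longrightarrow> segre_characteristic S' \<mu> = [2])))"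
proof -
  define N where "N = 2 * n"
  define J where "J = sympl_form n"
  define J2 where "J2 = sympl_form 1"
  define D where "D = mat_of_rows_list 2 [[l1, 0], [0, inverse l1]]"
  define D' where "D' = mat_of_rows_list 2 [[inverse l1, 0], [0, l1]]"
  define Y where "Y = J2 * X\<^sup>T * J\<^sup>T"
  define M where "M = D + R * J2\<^sup>T * D"
  have S: "S \<in> carrier_mat N N" and SJS: "S\<^sup>T * J * S = J"
    using assms(1) by (auto simp: symplectic_mat_def N_def J_def)
  have J: "J \<in> carrier_mat N N" unfolding J_def N_def by (rule sympl_form_carrier)
  have X: "X \<in> carrier_mat N 2" unfolding assms(6) N_def carrier_mat_def by simp
  have J2_eq: "J2 = mat_of_rows_list 2 [[0, 1], [-1, 0]]" unfolding J2_def by (rule sympl_form_1)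
  have J2: "J2 \<in> carrier_mat 2 2" and D: "D \<in> carrier_mat 2 2" and D': "D' \<in> carrier_mat 2 2"
    unfolding J2_eq D_def D'_def by (auto simp: mat_of_rows_list_def)
  note R = assms(8)
  have two: "{0..<2} = {0, 1 :: nat}" by auto
  have Xt: "X\<^sup>T \<in> carrier_mat 2 N" and Jt: "J\<^sup>T \<in> carrier_mat N N" using X J by auto
  have RJ2tD: "R * J2\<^sup>T * D \<in> carrier_mat 2 2"
    and M: "M \<in> carrier_mat 2 2" unfolding M_def using R J2 D by auto
  have Y: "Y \<in> carrier_mat 2 N" unfolding Y_def using J2 Xt Jt by auto
  note carriers = S J X J2 D D' R
  note dims = carriers[THEN carrier_matD(1)] carriers[THEN carrier_matD(2)]
  note mat_simps = mult_mat_assoc_dim transpose_mult_dim dims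
  have XtJX: "X\<^sup>T * J * X = J2" using assms(7) by (simp add: J_def J2_def)
  have J2J2t: "J2 * J2\<^sup>T = 1\<^sub>m 2" "J2\<^sup>T * J2 = 1\<^sub>m 2"
    unfolding J2_eq
    by (auto intro!: eq_matI simp: mat_of_rows_list_def scalar_prod_def two less_2_cases_iff)
  have Dt: "D\<^sup>T = D"
    unfolding D_def by (rule eq_matI) (auto simp: mat_of_rows_list_def numeral_2_eq_2 less_Suc_eq)
  have SX: "S * X = X * D"
  proof (rule eq_matI)
    fix i j assume ij: "i < dim_row (X * D)" "j < dim_col (X * D)"
    hence i: "i < N" and j: "j < 2" using X D by auto
    have x: "x1 \<in> carrier_vec N" "x2 \<in> carrier_vec N"
      "S *\<^sub>v x1 = l1 \<cdot>\<^sub>v x1" "S *\<^sub>v x2 = inverse l1 \<cdot>\<^sub>v x2"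
      using assms(4,5) S by (auto simp: eigenvector_def)
    have col: "col X 0 = x1" "col X 1 = x2"
      unfolding assms(6) using x by (auto simp: N_def)
    have Xij: "X $$ (i, 0) = x1 $ i" "X $$ (i, 1) = x2 $ i"
      using i X by (auto simp flip: col)
    have "(S * X) $$ (i, j) = (S *\<^sub>v col X j) $ i" using i j S X by simp
    also have "\<dots> = (X * D) $$ (i, j)"
      unfolding mult_mat_2_index[OF X D i j]
      using j i x by (auto simp: less_2_cases_iff col[unfolded One_nat_def] Xij[unfolded One_nat_def]
          D_def mat_of_rows_list_def)
    finally show "(S * X) $$ (i, j) = (X * D) $$ (i, j)" .
  qed (use S X D in auto)
  have StJSX: "S\<^sup>T * (J * (X * D)) = J * X"
  proof -
    have "S\<^sup>T * (J * (X * D)) = S\<^sup>T * J * S * X"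
      by (simp add: mat_simps flip: SX)
    thus ?thesis unfolding SJS .
  qed
  \<comment> \<open>\<open>S\<close> preserves the form, and \<open>X\<close> turns \<open>S\<close> into \<open>D\<close> and \<open>J\<close> into \<open>J2\<close>; so \<open>D\<close> is
    symplectic. Its entry \<open>l1 * inverse l1\<close> then has to be 1, which excludes \<open>l1 = 0\<close>, where
    \<open>inverse l1\<close> would be 0 by convention.\<close>
  have DJ2D: "D * J2 * D = J2"
  proof -
    have "J2 = X\<^sup>T * (J * X)" using XtJX assoc_mult_mat[OF Xt J X] by simp
    also have "\<dots> = (S * X)\<^sup>T * (J * (X * D))"
      unfolding StJSX[symmetric] by (simp add: mat_simps)
    also have "\<dots> = D * (X\<^sup>T * J * X) * D"
      unfolding SX by (simp add: mat_simps Dt)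
    finally show ?thesis unfolding XtJX by simp
  qed
  have l0: "l1 \<noteq> 0"
  proof
    assume "l1 = 0"
    hence "(D * J2 * D) $$ (0, 1) = 0"
      by (simp add: D_def J2_eq mat_of_rows_list_def scalar_prod_def two)
    thus False unfolding DJ2D by (simp add: J2_eq mat_of_rows_list_def)
  qed
  have m0: "\<mu> \<noteq> 0" "\<mu> \<noteq> l1" "\<mu> \<noteq> inverse l1" using assms(3) by auto
  have DD': "D' * D = 1\<^sub>m 2" and J2D': "J2 * D' = D * J2"
    using l0 by (auto intro!: eq_matI simp: D_def D'_def J2_eq mat_of_rows_list_def scalar_prod_def
        two less_2_cases_iff less_Suc_eq)
  have YX: "Y * X = 1\<^sub>m 2"
  proof -
    have "(X\<^sup>T * J * X)\<^sup>T = X\<^sup>T * J\<^sup>T * X"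
      by (simp add: mat_simps)
    hence "Y * X = J2 * J2\<^sup>T"
      unfolding Y_def XtJX by (simp add: mat_simps)
    thus ?thesis by (simp add: J2J2t)
  qed
  \<comment> \<open>Transposing \<open>StJSX\<close> gives \<open>X\<^sup>T J\<^sup>T = D X\<^sup>T J\<^sup>T S\<close>, so \<open>S\<close> acts on the rows of \<open>X\<^sup>T J\<^sup>T\<close> by
    \<open>D'\<close>, the inverse of \<open>D\<close>. The factor \<open>J2\<close> interchanges the two rows and turns \<open>D'\<close> into \<open>D\<close>.\<close>
  have YS: "Y * S = D * Y"
  proof -
    have "X\<^sup>T * J\<^sup>T = (J * X)\<^sup>T" using transpose_mult[OF J X] by simp
    also have "\<dots> = D * (X\<^sup>T * J\<^sup>T) * S"
      unfolding StJSX[symmetric] by (simp add: mat_simps Dt)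
    finally have "D' * (X\<^sup>T * J\<^sup>T) = D' * (D * (X\<^sup>T * J\<^sup>T) * S)" by simp
    also have "\<dots> = (D' * D) * (X\<^sup>T * J\<^sup>T) * S" by (simp add: mat_simps)
    also have "\<dots> = X\<^sup>T * J\<^sup>T * S"
      unfolding DD' using left_mult_one_mat[OF mult_carrier_mat[OF Xt Jt]] by simp
    finally have *: "X\<^sup>T * J\<^sup>T * S = D' * (X\<^sup>T * J\<^sup>T)" ..
    have "Y * S = J2 * (X\<^sup>T * J\<^sup>T * S)" unfolding Y_def by (simp add: mat_simps)
    also have "\<dots> = (J2 * D') * (X\<^sup>T * J\<^sup>T)" unfolding * by (simp add: mat_simps)
    also have "\<dots> = D * Y" unfolding J2D' Y_def by (simp add: mat_simps)
    finally show ?thesis .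
  qed
  have S'_eq: "S' = S + X * (M - D) * Y"
  proof -
    have MD: "M - D = R * J2\<^sup>T * D"
      unfolding M_def by (rule eq_matI) (use D RJ2tD in auto)
    have "X * (M - D) * Y = X * R * J2\<^sup>T * (D * Y)"
      unfolding MD using Y by (simp add: mat_simps)
    also have "\<dots> = X * R * (J2\<^sup>T * J2) * X\<^sup>T * J\<^sup>T * S"
      unfolding YS[symmetric] unfolding Y_def by (simp add: mat_simps)
    finally show ?thesis unfolding assms(11) J2J2t using X R by (simp add: J_def)
  qed
  have S': "S' \<in> carrier_mat N N" unfolding S'_eq using S X M D Y by auto
  have exchange: "mset (segre_characteristic S l) + mset (segre_characteristic M l)
      = mset (segre_characteristic S' l) + mset (segre_characteristic D l)" for l
    unfolding segre_block_diag[OF S M, symmetric] segre_block_diag[OF S' D, symmetric]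
      segre_similar[OF similar_exchange_block[OF S X Y D M YX SX YS S'_eq]] ..
  have M_ix: "M $$ (0,0) = l1 * (1 + R $$ (0,1))" "M $$ (0,1) = - (inverse l1 * R $$ (0,0))"
    "M $$ (1,0) = l1 * R $$ (1,1)" "M $$ (1,1) = inverse l1 * (1 - R $$ (1,0))"
    unfolding M_def using R
    by (auto simp: D_def J2_eq mat_of_rows_list_def scalar_prod_def two algebra_simps)
  have cpM: "char_poly M = [:- \<mu>, 1:] * [:- inverse \<mu>, 1:]"
  proof -
    have tr: "M $$ (0,0) + M $$ (1,1) = \<mu> + inverse \<mu>"
      unfolding M_ix using assms(9) by (simp add: algebra_simps)
    have "M $$ (0,0) * M $$ (1,1) - M $$ (0,1) * M $$ (1,0)
      = 1 + (R $$ (0, 1) - R $$ (1, 0) + R $$ (0, 0) * R $$ (1, 1) - R $$ (0, 1) * R $$ (1, 0))"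
      unfolding M_ix using l0 by (simp add: field_simps)
    hence dt: "M $$ (0,0) * M $$ (1,1) - M $$ (0,1) * M $$ (1,0) = 1"
      unfolding assms(10)[symmetric] by simp
    show ?thesis unfolding char_poly_2x2[OF M] tr dt using m0 by simp
  qed
  have cpD: "char_poly D = [:- l1, 1:] * [:- inverse l1, 1:]"
    unfolding char_poly_2x2[OF D] using l0 by (simp add: D_def mat_of_rows_list_def)
  have order1: "Polynomial.order a ([:- a, 1:] * [:- b, 1:]) = 1" if "a \<noteq> b" for a b :: complex
    using that by (subst order_mult) (auto simp: order_linear order_0I)
  have order2: "Polynomial.order a ([:- a, 1:] * [:- a, 1:]) = 2" for a :: complex
    by (subst order_mult) (auto simp: order_linear)
  have segM_l: "segre_characteristic M l1 = []" and segD_mu: "segre_characteristic D \<mu> = []"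
  proof -
    have "l1 \<noteq> inverse \<mu>" using m0 by (metis inverse_inverse_eq)
    hence "poly (char_poly M) l1 \<noteq> 0" "poly (char_poly D) \<mu> \<noteq> 0"
      using m0 unfolding cpM cpD poly_mult by simp_all
    thus "segre_characteristic M l1 = []" "segre_characteristic D \<mu> = []"
      using segre_empty[OF M] segre_empty[OF D] by auto
  qed
  have inv_self: "a = inverse a \<longleftrightarrow> a \<in> {1, -1}" if "a \<noteq> 0" for a :: complex
  proof -
    have "a = inverse a \<longleftrightarrow> a * a = 1" using that by (auto simp: field_simps)
    also have "\<dots> \<longleftrightarrow> a \<in> {1, -1}" using square_eq_1_iff[of a] by simp
    finally show ?thesis .
  qed
  have remove: "segre_characteristic S' l1 = ss"
    if "segre_characteristic S l1 = ss @ segre_characteristic D l1" for ss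
  proof (rule segre_eqI[OF S'])
    show "mset (segre_characteristic S' l1) = mset ss"
      using exchange[of l1] unfolding segM_l that by simp
    show "sorted (rev ss)" using sorted_segre[OF S, of l1] unfolding that by (simp add: sorted_append)
  qed
  have part1: "segre_characteristic S' l1 = ss"
    if "l1 \<notin> {1, -1}" "segre_characteristic S l1 = ss @ [1]" for ss
  proof -
    have "l1 \<noteq> inverse l1" using that(1) inv_self[OF l0] by simp
    hence "segre_characteristic D l1 = [1]" by (intro segre_simple[OF D]) (unfold cpD, rule order1)
    with that(2) remove show ?thesis by simp
  qed
  have part2: "segre_characteristic S' l1 = ss"
    if "l1 \<in> {1, -1}" "segre_characteristic S l1 = ss @ [1, 1]" for ss
  proof -
    have inv: "inverse l1 = l1" using that(1) inv_self[OF l0] by simp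
    have "D = l1 \<cdot>\<^sub>m 1\<^sub>m 2"
      unfolding D_def inv by (rule eq_matI) (auto simp: mat_of_rows_list_def less_2_cases_iff)
    moreover have "char_poly D = [:- l1, 1:] ^ 2" unfolding cpD inv by (simp only: power2_eq_square)
    ultimately have "segre_characteristic D l1 = [1, 1]"
      using segre_replicate_1_iff[OF D] by (simp add: numeral_2_eq_2)
    with that(2) remove show ?thesis by simp
  qed
  have segS': "segre_characteristic S' \<mu> = segre_characteristic M \<mu>" if "\<mu> \<notin> spectrum S"
  proof (rule segre_eqI[OF S'])
    have "segre_characteristic S \<mu> = []"
      using that by (intro segre_empty[OF S]) (simp add: spectrum_def eigenvalue_root_char_poly[OF S])
    thus "mset (segre_characteristic S' \<mu>) = mset (segre_characteristic M \<mu>)"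
      using exchange[of \<mu>] unfolding segD_mu by simp
  qed (rule sorted_segre[OF M])
  have part3: "segre_characteristic S' \<mu> = [1]" if "\<mu> \<notin> spectrum S" "\<mu> \<noteq> inverse \<mu>"
    unfolding segS'[OF that(1)]
    by (intro segre_simple[OF M]) (unfold cpM, rule order1[OF that(2)])
  have part4: "(segre_characteristic S' \<mu> = [1, 1] \<longleftrightarrow> R = R1 \<or> R = R2)
             \<and> (\<not> (R = R1 \<or> R = R2) \<longrightarrow> segre_characteristic S' \<mu> = [2])"
    if "\<mu> \<notin> spectrum S" "\<mu> = inverse \<mu>"
  proof -
    have inv: "inverse \<mu> = \<mu>" using that(2) by simp
    have mm: "\<mu> * \<mu> = 1" using m0(1) inv by (metis right_inverse)
    have cp: "char_poly M = [:- \<mu>, 1:] * [:- \<mu>, 1:]" unfolding cpM inv ..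
    have eq_iff: "A = B \<longleftrightarrow> A $$ (0,0) = B $$ (0,0) \<and> A $$ (0,1) = B $$ (0,1)
        \<and> A $$ (1,0) = B $$ (1,0) \<and> A $$ (1,1) = B $$ (1,1)"
      if "A \<in> carrier_mat 2 2" "B \<in> carrier_mat 2 2" for A B :: "complex mat"
      using that by (auto intro!: eq_matI simp: less_2_cases_iff)
    have R12: "R1 \<in> carrier_mat 2 2" "R2 \<in> carrier_mat 2 2"
      unfolding assms(12,13) by (auto simp: mat_of_rows_list_def)
    have inv_l: "inverse l1 * l1 = 1" using l0 by simp
    have "R2 = R1"
      unfolding eq_iff[OF R12(2,1)] unfolding assms(12,13) inv
      using inv_l mm by (simp add: mat_of_rows_list_def algebra_simps)
    moreover have "M = \<mu> \<cdot>\<^sub>m 1\<^sub>m 2 \<longleftrightarrow> R = R1"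
      unfolding eq_iff[OF R R12(1)] eq_iff[OF M smult_carrier_mat[OF one_carrier_mat]]
      unfolding M_ix assms(12) inv
      using l0 mm by (auto simp: mat_of_rows_list_def field_simps)
    moreover have "segre_characteristic M \<mu> = [1, 1] \<longleftrightarrow> M = \<mu> \<cdot>\<^sub>m 1\<^sub>m 2"
      using segre_replicate_1_iff[OF M, of \<mu>] cp by (simp add: numeral_2_eq_2)
    moreover have "segre_characteristic M \<mu> = [1, 1] \<or> segre_characteristic M \<mu> = [2]"
      by (rule segre_double[OF M]) (unfold cp, rule order2)
    ultimately show ?thesis unfolding segS'[OF that(1)] by auto
  qed
  show ?thesis using part1 part2 part3 part4 by blast
qed

end
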